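(* Let $(a(n))_{n\ge 0}$ be the integer sequence (OEIS A158690) defined by the formal power series identity $$\sum_{n\ge0}a(n)\frac{t^n}{n!}=1+\sum_{m\ge1}\prod_{j=1}^{m}\bigl(1-e^{-(2j-1)t}\bigr).$$ Then the following hold. (1) For every integer $k\ge2$, $a(n+\lambda(k))\equiv a(n)\pmod{k}$ for all sufficiently large $n$, where $\lambda$ is the Carmichael function. Since $\lambda(k)\mid\varphi(k)$, in particular, for every integer $k\ge1$ the sequence $a(n)$ modulo $k$ is eventually periodic with period dividing $\varphi(k)$. (2) For every integer $i\ge0$, every prime $p$, and all integers $n,r\ge1$, $$a(np^r+i)\equiv a(np^{r-1}+i)\pmod{p^r}.$$
   Context: All generating-function identities are identities of formal power series in $t$ with rational coefficients. The $m$-th product on the right-hand side has order at least $m$ at $t=0$, so each coefficient of the infinite sum receives contributions from only finitely many $m$. The numbers $a(n)$ are integers; the sequence begins $1,1,5,55,1073,32671,\ldots$. The Carmichael function $\lambda(k)$ is the least positive integer $\ell$ such that $x^{\ell}\equiv 1\pmod k$ for every integer $x$ coprime to $k$. The function $\varphi$ is Euler's totient function. A sequence $a(n)$ modulo $k$ is eventually periodic with period dividing $\varphi(k)$ if there is a positive integer $d\mid\varphi(k)$ such that $a(n+d)\equiv a(n)\pmod k$ for all sufficiently large $n$. *)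

theory Defs
  imports
    "HOL-Computational_Algebra.Formal_Power_Series"
    "HOL-Number_Theory.Residue_Primitive_Roots"
begin

text \<open>
  The library defines \<^const>\<open>Carmichael\<close> as the least common multiple of the orders of the
  units. It agrees with the definition as the least universal exponent.
\<close>

lemma Carmichael_eq_Least:
  assumes "k \<ge> 1"
  shows "Carmichael k =
    (LEAST l. l > 0 \<and> (\<forall>x::int. coprime x (int k) \<longrightarrow> [x ^ l = 1] (mod int k)))"
proof (rule Least_equality[symmetric], intro conjI allI impI)
  fix x :: int
  assume x: "coprime x (int k)"
  define y where "y = nat (x mod int k)"
  have y: "int y = x mod int k"
    using assms by (simp add: y_def)
  have "coprime (int k) (int y)"
    using x assms by (simp add: y coprime_commute)
  then have "[y ^ Carmichael k = 1] (mod k)"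
    by (intro Carmichael_divides) auto
  then have "[int y ^ Carmichael k = 1] (mod int k)"
    by (metis cong_int_iff of_nat_1 of_nat_power)
  then show "[x ^ Carmichael k = 1] (mod int k)"
    by (simp add: y cong_def power_mod)
next
  fix l
  assume l: "l > 0 \<and> (\<forall>x::int. coprime x (int k) \<longrightarrow> [x ^ l = 1] (mod int k))"
  have "ord k a dvd l" if "a \<in> totatives k" for a
  proof -
    have "coprime (int a) (int k)"
      using that by (simp add: totatives_def)
    with l have "[int a ^ l = 1] (mod int k)"
      by blast
    then have "[a ^ l = 1] (mod k)"
      by (metis cong_int_iff of_nat_1 of_nat_power)
    then show ?thesis
      using ord_divides by blast
  qed
  then have "Carmichael k dvd l"
    unfolding Carmichael_def by (intro Lcm_least) auto
  then show "Carmichael k \<le> l"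
    using l by (auto dest: dvd_imp_le)
qed simp

text \<open>
  Infinite sums of formal power series are taken in the topology of coefficientwise stabilisation.
  The next two results show that the series defining the sequence converges and that there is exactly
  one integer sequence with this exponential generating function.
\<close>

lemma nth_prod_one_minus_fps_exp:
  assumes "n < m"
  shows "fps_nth (\<Prod>j=1..m. (1 - fps_exp (c j) :: rat fps)) n = 0"
  using assms
proof (induction m arbitrary: n)
  case (Suc m)
  have "fps_nth (\<Prod>j=1..m. (1 - fps_exp (c j) :: rat fps)) i
          * fps_nth (1 - fps_exp (c (Suc m))) (n - i) = 0" if "i \<le> n" for i
    using Suc.IH[of i] Suc.prems that by (cases "i < m") auto
  then have "fps_nth ((\<Prod>j=1..m. (1 - fps_exp (c j) :: rat fps)) * (1 - fps_exp (c (Suc m)))) n = 0"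
    unfolding fps_mult_nth by (intro sum.neutral) auto
  then show ?case
    by (simp add: mult.commute)
qed simp

lemma sums_A158690:
  "summable (\<lambda>m. \<Prod>j=1..Suc m. (1 - fps_exp (- (2 * of_nat j - 1)) :: rat fps))"
  "fps_nth (\<Sum>m. \<Prod>j=1..Suc m. (1 - fps_exp (- (2 * of_nat j - 1)) :: rat fps)) n =
     (\<Sum>m<n. fps_nth (\<Prod>j=1..Suc m. (1 - fps_exp (- (2 * of_nat j - 1)))) n)"
proof -
  define P where "P = (\<lambda>m. \<Prod>j=1..Suc m. (1 - fps_exp (- (2 * of_nat j - 1)) :: rat fps))"
  have zero: "fps_nth (P m) n = 0" if "n \<le> m" for m n
    unfolding P_def by (rule nth_prod_one_minus_fps_exp) (use that in simp)
  have "(\<lambda>N. \<Sum>m<N. P m) \<longlonglongrightarrow> Abs_fps (\<lambda>n. \<Sum>m<n. fps_nth (P m) n)"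
  proof (rule tendsto_fpsI)
    fix n
    have "fps_nth (\<Sum>m<N. P m) n = (\<Sum>m<n. fps_nth (P m) n)" if "N \<ge> n" for N
      unfolding fps_sum_nth by (rule sum.mono_neutral_right) (use that zero in auto)
    then show "\<forall>\<^sub>F N in sequentially.
        fps_nth (\<Sum>m<N. P m) n = fps_nth (Abs_fps (\<lambda>n. \<Sum>m<n. fps_nth (P m) n)) n"
      by (auto simp: eventually_sequentially)
  qed
  then have *: "P sums Abs_fps (\<lambda>n. \<Sum>m<n. fps_nth (P m) n)"
    by (simp add: sums_def)
  then show "summable (\<lambda>m. \<Prod>j=1..Suc m. (1 - fps_exp (- (2 * of_nat j - 1)) :: rat fps))"
    unfolding P_def by (rule sums_summable)
  have "suminf P = Abs_fps (\<lambda>n. \<Sum>m<n. fps_nth (P m) n)"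
    using * by (rule sums_unique[symmetric])
  then show "fps_nth (\<Sum>m. \<Prod>j=1..Suc m. (1 - fps_exp (- (2 * of_nat j - 1)) :: rat fps)) n =
     (\<Sum>m<n. fps_nth (\<Prod>j=1..Suc m. (1 - fps_exp (- (2 * of_nat j - 1)))) n)"
    unfolding P_def by simp
qed

lemma fact_nth_mult_Ints:
  fixes f g :: "rat fps"
  assumes "\<And>n. fact n * fps_nth f n \<in> \<int>" "\<And>n. fact n * fps_nth g n \<in> \<int>"
  shows "fact n * fps_nth (f * g) n \<in> \<int>"
proof -
  have "fact n * fps_nth (f * g) n =
      (\<Sum>i=0..n. of_nat (n choose i) * (fact i * fps_nth f i) * (fact (n - i) * fps_nth g (n - i)))"
    unfolding fps_mult_nth sum_distrib_left
    by (intro sum.cong refl) (simp add: binomial_fact field_simps)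
  also have "\<dots> \<in> \<int>"
    by (intro Ints_sum Ints_mult assms Ints_of_nat)
  finally show ?thesis .
qed

lemma ex1_A158690:
  "\<exists>!a :: nat \<Rightarrow> int. Abs_fps (\<lambda>n. of_int (a n) / fact n) =
     (1 + (\<Sum>m. \<Prod>j=1..Suc m. (1 - fps_exp (- (2 * of_nat j - 1)))) :: rat fps)"
proof -
  define F where
    "F = (1 + (\<Sum>m. \<Prod>j=1..Suc m. (1 - fps_exp (- (2 * of_nat j - 1)))) :: rat fps)"
  have factor: "fact n * fps_nth (1 - fps_exp (- (2 * of_nat j - 1)) :: rat fps) n \<in> \<int>" for j n
    by (auto simp: algebra_simps intro!: Ints_diff Ints_power Ints_mult)
  have prod: "fact n * fps_nth (\<Prod>j=1..m. (1 - fps_exp (- (2 * of_nat j - 1)) :: rat fps)) n \<in> \<int>"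
    for m n
  proof (induction m arbitrary: n)
    case (Suc m)
    show ?case
      using fact_nth_mult_Ints[OF Suc.IH factor[of _ "Suc m"], of n]
      by (simp add: mult.commute)
  qed simp
  have "fact n * fps_nth F n \<in> \<int>" for n
    unfolding F_def fps_add_nth sums_A158690(2) distrib_left sum_distrib_left
    by (intro Ints_add Ints_sum prod) simp
  then have "\<forall>n. \<exists>z. fact n * fps_nth F n = of_int z"
    by (auto elim!: Ints_cases)
  then obtain a where a: "\<And>n. fact n * fps_nth F n = of_int (a n)"
    by metis
  show ?thesis
    unfolding F_def[symmetric]
  proof (rule ex1I)
    show "Abs_fps (\<lambda>n. of_int (a n) / fact n) = F"
      by (rule fps_ext) (simp flip: a)
  next
    fix b :: "nat \<Rightarrow> int"
    assume b: "Abs_fps (\<lambda>n. of_int (b n) / fact n) = F"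
    show "b = a"
    proof
      fix n
      have "of_int (b n) = (of_int (a n) :: rat)"
        unfolding a[symmetric] b[symmetric] by simp
      then show "b n = a n"
        by simp
    qed
  qed
qed

end

theory Submission
  imports Defs
begin

text \<open>
  Put \<open>q = e\<^sup>-\<^sup>t\<close>. The sequence attached to \<open>q\<^sup>c\<close> is \<open>n \<mapsto> (- c)\<^sup>n\<close>, so a finite integer
  combination of powers of \<open>q\<close> has as its sequence an integer combination of functions
  \<open>n \<mapsto> c\<^sup>n\<close>. All congruences claimed here hold for each such function: they are forms of Euler's
  theorem (\<open>power_add_Carmichael_cong\<close>, \<open>power_prime_power_cong\<close>).

  The series that defines \<open>a\<close> is an infinite sum, but it becomes finite modulo \<open>k\<close>. Say that
  an exponential generating function is divisible by \<open>k\<close> if all its terms \<open>n! [t\<^sup>n]\<close> are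
  divisible by \<open>k\<close>; this is multiplicative, as binomial convolution preserves integers. If
  \<open>k\<close> is odd, then it divides some odd number \<open>2 * j - 1\<close>, and the factor \<open>1 - q\<^bsup>2j-1\<^esup>\<close> is
  divisible by \<open>k\<close> because its constant term is zero. The product of any two factors is
  divisible by \<open>2\<close>, because for odd \<open>b\<close> and \<open>c\<close> the terms \<open>(b + c)\<^sup>n - b\<^sup>n - c\<^sup>n\<close> with \<open>n > 0\<close>
  are even and the constant term is again zero. So for each \<open>k\<close> all sufficiently long products
  are divisible by \<open>k\<close> (\<open>factors_block_egf_dvd\<close>), and \<open>a\<close> agrees modulo \<open>k\<close>, for all
  indices at once, with an integer combination of functions \<open>n \<mapsto> c\<^sup>n\<close>. The number of terms
  depends on \<open>k\<close>, but this is harmless since each congruence involves a single modulus.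
\<close>

section \<open>Congruences between powers\<close>

text \<open>
  Dividing \<open>k\<close> repeatedly by its common divisor with \<open>c\<close> leaves \<open>v\<close>. Each division makes \<open>k\<close>
  smaller, so there are fewer than \<open>k\<close> of them, and each contributes a divisor of \<open>c\<close> to \<open>u\<close>.
\<close>

lemma coprime_factorization_wrt:
  fixes k c :: nat
  assumes "k > 0"
  obtains u v where "k = u * v" "coprime v c" "u dvd c ^ k"
proof -
  have "\<exists>u v. k = u * v \<and> coprime v c \<and> u dvd c ^ k"
    using assms
  proof (induction k rule: less_induct)
    case (less k)
    show ?case
    proof (cases "coprime k c")
      case True
      then show ?thesis
        by (intro exI[of _ 1] exI[of _ k]) auto
    next
      case False
      define g where "g = gcd k c"
      from False have "g \<noteq> 1"
        by (simp add: g_def coprime_iff_gcd_eq_1)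
      with less.prems have "g > 1"
        by (metis g_def gcd_eq_0_iff less_one linorder_neqE_nat not_less_zero)
      obtain l where l: "k = g * l"
        unfolding g_def by (meson dvdE gcd_dvd1)
      with \<open>g > 1\<close> less.prems have "0 < l" "l < k"
        by auto
      then obtain u v where uv: "l = u * v" "coprime v c" "u dvd c ^ l"
        using less.IH by blast
      have "g * u dvd c * c ^ l"
        using uv(3) by (intro mult_dvd_mono) (simp_all add: g_def)
      also have "\<dots> dvd c ^ k"
        using \<open>l < k\<close> by (metis Suc_leI le_imp_power_dvd power_Suc)
      finally show ?thesis
        using uv l by (metis mult.assoc)
    qed
  qed
  then show thesis
    using that by blast
qed

text \<open>
  The modulus splits into a part that divides \<open>c ^ k\<close>, where both sides vanish, and a part
  coprime to \<open>c\<close>, whose Carmichael number divides that of \<open>k\<close>.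
\<close>

lemma power_add_Carmichael_cong:
  fixes c k n :: nat
  assumes "k > 0" "k \<le> n"
  shows "[c ^ (n + Carmichael k) = c ^ n] (mod k)"
proof -
  obtain u v where uv: "k = u * v" "coprime v c" "u dvd c ^ k"
    using coprime_factorization_wrt[OF assms(1)] .
  have "coprime (c ^ k) v"
    using uv(2) by (simp add: coprime_commute)
  then have "coprime u v"
    using uv(3) by (meson coprime_divisors dvd_refl)
  have "u dvd c ^ n"
    using uv(3) assms(2) by (meson dvd_trans le_imp_power_dvd)
  then have "[c ^ (n + Carmichael k) = c ^ n] (mod u)"
    by (simp add: power_add cong_def mod_eq_0_iff_dvd)
  moreover have "Carmichael v dvd Carmichael k"
    using Carmichael_mult_coprime[OF \<open>coprime u v\<close>] uv(1) by simp
  then have "[c ^ Carmichael k = 1] (mod v)"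
    using uv(2) by (rule Carmichael_divides)
  then have "[c ^ (n + Carmichael k) = c ^ n] (mod v)"
    by (metis cong_scalar_left mult.right_neutral power_add)
  ultimately show ?thesis
    unfolding uv(1) using \<open>coprime u v\<close> by (rule coprime_cong_mult_nat)
qed

text \<open>
  For \<open>c\<close> coprime to \<open>p\<close> this is Euler's theorem, since the two exponents differ by the totient
  of \<open>p ^ r\<close>. Otherwise both sides vanish, because \<open>r \<le> p ^ (r - 1)\<close>.
\<close>

lemma power_prime_power_cong:
  fixes c p r :: nat
  assumes "prime p" "r > 0"
  shows "[c ^ (p ^ r) = c ^ (p ^ (r - 1))] (mod (p ^ r))"
proof (cases "p dvd c")
  case True
  have "r - 1 < p ^ (r - 1)"
    using prime_gt_1_nat[OF assms(1)] by (intro power_gt_expt) simp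
  then have "r \<le> p ^ (r - 1)"
    by simp
  moreover have "p ^ (r - 1) \<le> p ^ r"
    using prime_gt_0_nat[OF assms(1)] by (intro power_increasing) auto
  ultimately have "p ^ r dvd c ^ (p ^ (r - 1))" "p ^ r dvd c ^ (p ^ r)"
    using True by (meson dvd_power_le order_trans)+
  then show ?thesis
    by (simp add: cong_def mod_eq_0_iff_dvd)
next
  case False
  then have "coprime p c"
    using assms(1) prime_imp_coprime by blast
  then have "coprime c (p ^ r)"
    by (simp add: coprime_commute)
  then have *: "[c ^ totient (p ^ r) = 1] (mod (p ^ r))"
    by (rule euler_theorem)
  obtain s where s: "r = Suc s"
    using assms(2) by (cases r) auto
  obtain q where q: "p = Suc q"
    using prime_gt_0_nat[OF assms(1)] by (cases p) auto
  have "totient (p ^ r) = p ^ s * q"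
    unfolding s totient_prime_power_Suc[OF assms(1)] by (simp add: q)
  then have "p ^ r = p ^ (r - 1) + totient (p ^ r)"
    by (simp add: s q)
  then have "c ^ (p ^ r) = c ^ (p ^ (r - 1)) * c ^ totient (p ^ r)"
    by (metis power_add)
  then show ?thesis
    using cong_scalar_left[OF *, of "c ^ (p ^ (r - 1))"] by simp
qed

lemma power_cong_int_of_nat:
  fixes c :: int and k m n :: nat
  assumes "\<And>c::nat. [c ^ m = c ^ n] (mod k)" "k > 0"
  shows "[c ^ m = c ^ n] (mod int k)"
proof -
  define b where "b = nat (c mod int k)"
  have b: "[c = int b] (mod int k)"
    using assms(2) by (simp add: b_def cong_def)
  have "[c ^ m = int b ^ m] (mod int k)"
    using b by (rule cong_pow)
  also have "[int b ^ m = int b ^ n] (mod int k)"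
    using assms(1)[of b] by (metis cong_int_iff of_nat_power)
  also have "[int b ^ n = c ^ n] (mod int k)"
    using b by (metis cong_pow cong_sym)
  finally show ?thesis .
qed


section \<open>Divisibility of exponential generating functions\<close>

definition egf_dvd :: "int \<Rightarrow> rat fps \<Rightarrow> bool" where
  "egf_dvd k f \<longleftrightarrow> (\<forall>n. \<exists>z. fact n * fps_nth f n = of_int (k * z))"

lemma egf_dvd_0: "egf_dvd k 0"
  by (auto simp: egf_dvd_def intro: exI[of _ 0])

lemma egf_dvd_add:
  assumes "egf_dvd k f" "egf_dvd k g"
  shows "egf_dvd k (f + g)"
  using assms unfolding egf_dvd_def fps_add_nth distrib_left
  by (metis distrib_left of_int_add)

lemma egf_dvd_mult:
  assumes "egf_dvd k f" "egf_dvd l g"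
  shows "egf_dvd (k * l) (f * g)"
proof -
  obtain x where x: "\<And>n. fact n * fps_nth f n = of_int (k * x n)"
    using assms(1) unfolding egf_dvd_def by metis
  obtain y where y: "\<And>n. fact n * fps_nth g n = of_int (l * y n)"
    using assms(2) unfolding egf_dvd_def by metis
  have "fact n * fps_nth (f * g) n =
      of_int (k * l * (\<Sum>i=0..n. int (n choose i) * x i * y (n - i)))" for n
  proof -
    have "fact n * fps_nth (f * g) n =
        (\<Sum>i=0..n. of_nat (n choose i) * (fact i * fps_nth f i) * (fact (n - i) * fps_nth g (n - i)))"
      unfolding fps_mult_nth sum_distrib_left
      by (intro sum.cong refl) (simp add: binomial_fact field_simps)
    also have "\<dots> = of_int (k * l * (\<Sum>i=0..n. int (n choose i) * x i * y (n - i)))"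
      unfolding x y by (simp add: sum_distrib_left mult_ac)
    finally show ?thesis .
  qed
  then show ?thesis
    unfolding egf_dvd_def by blast
qed

lemma fact_nth_fps_exp: "fact n * fps_nth (fps_exp (of_int c) :: rat fps) n = of_int (c ^ n)"
  by simp

lemma egf_dvd_one_minus_fps_exp:
  assumes "k dvd c"
  shows "egf_dvd k (1 - fps_exp (of_int c))"
  unfolding egf_dvd_def
proof
  fix n
  show "\<exists>z. fact n * fps_nth (1 - fps_exp (of_int c) :: rat fps) n = of_int (k * z)"
  proof (cases n)
    case (Suc m)
    have "k dvd - (c ^ n)"
      using assms Suc by simp
    then obtain z where "- (c ^ n) = k * z" ..
    then show ?thesis
      using Suc by (metis (no_types, lifting) diff_0 fact_nth_fps_exp fps_one_nth fps_sub_nth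
          mult_minus_right nat.distinct(1) of_int_minus)
  qed (auto intro: exI[of _ 0])
qed

lemma egf_dvd_2_one_minus_fps_exp_mult:
  assumes "odd b" "odd c"
  shows "egf_dvd 2 ((1 - fps_exp (of_int b)) * (1 - fps_exp (of_int c)))"
  unfolding egf_dvd_def
proof
  fix n
  have eq: "(1 - fps_exp (of_int b)) * (1 - fps_exp (of_int c)) =
      (1 - fps_exp (of_int b) - fps_exp (of_int c) + fps_exp (of_int (b + c)) :: rat fps)"
    by (simp add: algebra_simps fps_exp_add_mult)
  show "\<exists>z. fact n * fps_nth ((1 - fps_exp (of_int b)) * (1 - fps_exp (of_int c)) :: rat fps) n
      = of_int (2 * z)"
  proof (cases n)
    case (Suc m)
    have "even ((b + c) ^ n - b ^ n - c ^ n)"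
      using assms Suc by simp
    then obtain z where z: "(b + c) ^ n - b ^ n - c ^ n = 2 * z" ..
    have "fact n * fps_nth ((1 - fps_exp (of_int b)) * (1 - fps_exp (of_int c)) :: rat fps) n
        = of_int ((b + c) ^ n - b ^ n - c ^ n)"
      unfolding eq unfolding fps_add_nth fps_sub_nth distrib_left right_diff_distrib fact_nth_fps_exp
      using Suc by simp
    then show ?thesis
      unfolding z by blast
  qed (auto intro: exI[of _ 0])
qed


section \<open>Long products of factors are divisible by a given integer\<close>

definition factor :: "nat \<Rightarrow> rat fps" where
  "factor j = 1 - fps_exp (of_int (1 - 2 * int j))"

lemma egf_dvd_prod_factor: "egf_dvd 1 (prod factor A)"
proof (induction A rule: infinite_finite_induct)
  case (insert j A)
  have "egf_dvd 1 (factor j)"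
    unfolding factor_def by (rule egf_dvd_one_minus_fps_exp) simp
  from egf_dvd_mult[OF this insert.IH] insert.hyps show ?case
    by simp
qed (use egf_dvd_one_minus_fps_exp[of 1 0] in \<open>auto simp: egf_dvd_def\<close>)

text \<open>
  Blocks starting at an arbitrary index \<open>s\<close> allow an induction over the factors of \<open>k\<close>: a block
  for the odd part is preceded by one block of length two for each factor \<open>2\<close>.
\<close>

lemma factors_block_egf_dvd:
  assumes "k > 0"
  shows "\<exists>M\<ge>s. egf_dvd (int k) (prod factor {s..<M})"
  using assms
proof (induction k arbitrary: s rule: less_induct)
  case (less k)
  show ?case
  proof (cases "even k")
    case True
    then obtain l where l: "k = 2 * l" ..
    with less.prems have "l > 0" "l < k"
      by auto
    then obtain M where M: "M \<ge> s + 2" "egf_dvd (int l) (prod factor {s + 2..<M})"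
      using less.IH by blast
    have "{s..<s + 2} = {s, Suc s}"
      by auto
    then have "egf_dvd 2 (prod factor {s..<s + 2})"
      by (simp add: factor_def egf_dvd_2_one_minus_fps_exp_mult del: of_int_diff)
    from egf_dvd_mult[OF this M(2)]
    have "egf_dvd (int k) (prod factor {s..<s + 2} * prod factor {s + 2..<M})"
      by (simp add: l)
    also have "prod factor {s..<s + 2} * prod factor {s + 2..<M} = prod factor {s..<M}"
      using M(1) by (intro prod.atLeastLessThan_concat) auto
    finally show ?thesis
      using M(1) by (intro exI[of _ M]) auto
  next
    case False
    then obtain h where h: "k = 2 * h + 1" ..
    \<comment> \<open>Then \<open>2 * j - 1 = (2 * s + 1) * k\<close>.\<close>
    define j where "j = k * s + h + 1"
    have "s \<le> k * s"
      using less.prems by simp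
    then have "s \<le> j"
      unfolding j_def by linarith
    have "1 - 2 * int j = int k * (- 2 * int s - 1)"
      by (simp add: j_def h algebra_simps)
    then have "egf_dvd (int k) (factor j)"
      unfolding factor_def by (intro egf_dvd_one_minus_fps_exp) (metis dvd_triv_left)
    from egf_dvd_mult[OF egf_dvd_prod_factor this]
    have "egf_dvd (int k) (prod factor {s..<Suc j})"
      using \<open>s \<le> j\<close> by simp
    then show ?thesis
      using \<open>s \<le> j\<close> by (intro exI[of _ "Suc j"]) auto
  qed
qed

lemma eventually_egf_dvd_prod_factor:
  assumes "k > 0"
  obtains M where "\<And>m. m \<ge> M \<Longrightarrow> egf_dvd (int k) (prod factor {1..Suc m})"
proof -
  obtain M where M: "M \<ge> 1" "egf_dvd (int k) (prod factor {1..<M})"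
    using factors_block_egf_dvd[OF assms] by blast
  have "egf_dvd (int k) (prod factor {1..Suc m})" if "m \<ge> M" for m
  proof -
    have "{1..Suc m} = {1..<Suc (Suc m)}"
      by auto
    then have "prod factor {1..Suc m} = prod factor {1..<M} * prod factor {M..<Suc (Suc m)}"
      using M(1) that by (simp only:) (intro prod.atLeastLessThan_concat[symmetric], auto)
    then show ?thesis
      using egf_dvd_mult[OF M(2) egf_dvd_prod_factor] by (simp only: mult_1_right)
  qed
  then show thesis
    using that by blast
qed


section \<open>Integer combinations of exponentials\<close>

text \<open>
  This is the ring \<open>\<int>[q, q\<inverse>]\<close>. It is generated as an additive group, with differences alone, so
  that properties linear in the series need only be checked on exponentials.
\<close>

inductive_set exp_ring :: "rat fps set" where
  exp: "fps_exp (of_int c) \<in> exp_ring"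
| diff: "f \<in> exp_ring \<Longrightarrow> g \<in> exp_ring \<Longrightarrow> f - g \<in> exp_ring"

lemma one_in_exp_ring: "1 \<in> exp_ring"
  using exp_ring.exp[of 0] by simp

lemma exp_ring_add:
  assumes "f \<in> exp_ring" "g \<in> exp_ring"
  shows "f + g \<in> exp_ring"
  using exp_ring.diff[OF assms(1) exp_ring.diff[OF exp_ring.diff[OF assms(2) assms(2)] assms(2)]]
  by simp

lemma exp_ring_mult:
  assumes "f \<in> exp_ring" "g \<in> exp_ring"
  shows "f * g \<in> exp_ring"
  using assms
proof (induction f)
  case (exp b)
  from exp.prems show ?case
  proof (induction g)
    case (exp c)
    show ?case
      using exp_ring.exp[of "b + c"] by (simp add: fps_exp_add_mult)
  qed (simp add: right_diff_distrib exp_ring.diff)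
qed (simp add: left_diff_distrib exp_ring.diff)

lemma prod_factor_in_exp_ring: "prod factor A \<in> exp_ring"
proof (induction A rule: infinite_finite_induct)
  case (insert j A)
  have "factor j \<in> exp_ring"
    unfolding factor_def by (intro exp_ring.diff exp_ring.exp one_in_exp_ring)
  with insert show ?case
    by (simp add: exp_ring_mult)
qed (simp_all add: one_in_exp_ring)

lemma one_plus_sum_in_exp_ring:
  fixes M :: nat
  assumes "\<And>m. f m \<in> exp_ring"
  shows "1 + (\<Sum>m<M. f m) \<in> exp_ring"
proof (induction M)
  case (Suc M)
  from exp_ring_add[OF this assms[of M]] show ?case
    by (simp add: add.assoc)
qed (simp add: one_in_exp_ring)

lemma exp_ring_coeff_cong:
  assumes "f \<in> exp_ring" "\<And>c::int. [c ^ m = c ^ n] (mod k)"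
  shows "\<exists>z. fact m * fps_nth f m - fact n * fps_nth f n = of_int (k * z)"
  using assms(1)
proof induction
  case (exp c)
  obtain z where "c ^ m - c ^ n = k * z"
    using assms(2)[of c] by (meson cong_iff_dvd_diff dvdE)
  then show ?case
    unfolding fact_nth_fps_exp by (metis of_int_diff)
next
  case (diff f g)
  then obtain x y where
    "fact m * fps_nth f m - fact n * fps_nth f n = of_int (k * x)"
    "fact m * fps_nth g m - fact n * fps_nth g n = of_int (k * y)"
    by blast
  then have "fact m * fps_nth (f - g) m - fact n * fps_nth (f - g) n = of_int (k * (x - y))"
    by (simp add: algebra_simps)
  then show ?case
    by blast
qed


section \<open>Congruences for the sequence\<close>

lemma factor_eq: "1 - fps_exp (- (2 * of_nat j - 1)) = factor j"
  by (simp add: factor_def)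

lemma fps_nth_series_eq:
  assumes "n \<le> N"
  shows "fps_nth (\<Sum>m. prod factor {1..Suc m}) n = (\<Sum>m<N. fps_nth (prod factor {1..Suc m}) n)"
proof -
  have "fps_nth (\<Sum>m. prod factor {1..Suc m}) n = (\<Sum>m<n. fps_nth (prod factor {1..Suc m}) n)"
    using sums_A158690(2)[of n] unfolding factor_eq .
  also have "\<dots> = (\<Sum>m<N. fps_nth (prod factor {1..Suc m}) n)"
  proof (rule sum.mono_neutral_left)
    show "\<forall>m\<in>{..<N} - {..<n}. fps_nth (prod factor {1..Suc m}) n = 0"
    proof
      fix m
      assume "m \<in> {..<N} - {..<n}"
      then have "n < Suc m"
        by auto
      then show "fps_nth (prod factor {1..Suc m}) n = 0"
        unfolding factor_def by (rule nth_prod_one_minus_fps_exp)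
    qed
  qed (use assms in auto)
  finally show ?thesis .
qed

lemma series_cong_exp_ring:
  assumes "k > 0"
  obtains g where "g \<in> exp_ring" "egf_dvd (int k) (1 + (\<Sum>m. prod factor {1..Suc m}) - g)"
proof -
  obtain M where M: "\<And>m. m \<ge> M \<Longrightarrow> egf_dvd (int k) (prod factor {1..Suc m})"
    using eventually_egf_dvd_prod_factor[OF assms] by blast
  define g where "g = 1 + (\<Sum>m<M. prod factor {1..Suc m})"
  have "egf_dvd (int k) (1 + (\<Sum>m. prod factor {1..Suc m}) - g)"
    unfolding egf_dvd_def
  proof
    fix n
    \<comment> \<open>The infinite tail from \<open>M\<close> on is not a finite sum, but for the coefficient at \<open>n\<close> it can be
      cut off anywhere beyond \<open>n\<close>.\<close>
    define h where "h = (\<Sum>m\<in>{M..<M + n}. prod factor {1..Suc m})"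
    have "egf_dvd (int k) (\<Sum>m\<in>A. prod factor {1..Suc m})" if "finite A" "A \<subseteq> {M..}" for A
      using that
    proof induction
      case (insert m A)
      then show ?case
        using egf_dvd_add[OF M[of m]] by simp
    qed (simp add: egf_dvd_0)
    then have "egf_dvd (int k) h"
      unfolding h_def by (meson atLeastLessThan_iff atLeast_iff finite_atLeastLessThan subsetI)
    moreover have "fps_nth (1 + (\<Sum>m. prod factor {1..Suc m}) - g) n = fps_nth h n"
    proof -
      have "(\<Sum>m<M + n. fps_nth (prod factor {1..Suc m}) n) =
          (\<Sum>m<M. fps_nth (prod factor {1..Suc m}) n)
          + (\<Sum>m\<in>{M..<M + n}. fps_nth (prod factor {1..Suc m}) n)"
        unfolding lessThan_atLeast0 by (intro sum.atLeastLessThan_concat[symmetric]) auto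
      then show ?thesis
        unfolding g_def h_def fps_add_nth fps_sub_nth fps_sum_nth
          fps_nth_series_eq[of n "M + n", OF le_add2]
        by simp
    qed
    ultimately show "\<exists>z. fact n * fps_nth (1 + (\<Sum>m. prod factor {1..Suc m}) - g) n
        = of_int (int k * z)"
      unfolding egf_dvd_def by simp
  qed
  moreover have "g \<in> exp_ring"
    unfolding g_def by (intro one_plus_sum_in_exp_ring prod_factor_in_exp_ring)
  ultimately show thesis
    using that by blast
qed

text \<open>
  Modulo \<open>k\<close> the sequence is an integer combination of functions \<open>n \<mapsto> c ^ n\<close>, so it inherits
  every congruence modulo \<open>k\<close> that holds for all of them.
\<close>

lemma cong_if_powers_cong:
  fixes a :: "nat \<Rightarrow> int" and k m n :: nat
  assumes egf: "Abs_fps (\<lambda>n. of_int (a n) / fact n) =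
      (1 + (\<Sum>m. \<Prod>j=1..Suc m. (1 - fps_exp (- (2 * of_nat j - 1)))) :: rat fps)"
    and "k > 0" and "\<And>c::nat. [c ^ m = c ^ n] (mod k)"
  shows "[a m = a n] (mod int k)"
proof -
  obtain g where g: "g \<in> exp_ring" "egf_dvd (int k) (1 + (\<Sum>m. prod factor {1..Suc m}) - g)"
    using series_cong_exp_ring[OF assms(2)] .
  have a: "\<exists>z. of_int (a i) - fact i * fps_nth g i = of_int (int k * z)" for i
  proof -
    have "fps_nth (1 + (\<Sum>m. prod factor {1..Suc m})) i = of_int (a i) / fact i"
      using arg_cong[OF egf, of "\<lambda>f. fps_nth f i"] unfolding factor_eq by simp
    then have "fact i * fps_nth (1 + (\<Sum>m. prod factor {1..Suc m}) - g) i
        = of_int (a i) - fact i * fps_nth g i"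
      unfolding fps_sub_nth right_diff_distrib by simp
    then show ?thesis
      using g(2) unfolding egf_dvd_def by metis
  qed
  obtain x y where
    "of_int (a m) - fact m * fps_nth g m = of_int (int k * x)"
    "of_int (a n) - fact n * fps_nth g n = of_int (int k * y)"
    using a by blast
  moreover obtain z where "fact m * fps_nth g m - fact n * fps_nth g n = of_int (int k * z)"
    using exp_ring_coeff_cong[OF g(1) power_cong_int_of_nat[OF assms(3,2)]] by blast
  ultimately have "of_int (a m - a n) = (of_int (int k * (x - y + z)) :: rat)"
    by (simp add: algebra_simps)
  then have "a m - a n = int k * (x - y + z)"
    by (simp only: of_int_eq_iff)
  then show ?thesis
    by (simp add: cong_iff_dvd_diff)
qed

theorem theorem1p1:
  fixes a :: "nat \<Rightarrow> int"
  assumes egf: "Abs_fps (\<lambda>n. of_int (a n) / fact n) =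
    (1 + (\<Sum>m. \<Prod>j=1..Suc m. (1 - fps_exp (- (2 * of_nat j - 1)))) :: rat fps)"
  shows "((\<forall>k::nat\<ge>2. \<forall>\<^sub>F n in sequentially. [a (n + Carmichael k) = a n] (mod int k)) \<and>
      (\<forall>k::nat\<ge>2. Carmichael k dvd totient k) \<and>
      (\<forall>k::nat\<ge>1. \<exists>d>0. d dvd totient k \<and>
         (\<forall>\<^sub>F n in sequentially. [a (n + d) = a n] (mod int k)))) \<and>
    (\<forall>(i::nat) (p::nat) (n::nat) (r::nat). prime p \<and> n \<ge> 1 \<and> r \<ge> 1 \<longrightarrow>
       [a (n * p ^ r + i) = a (n * p ^ (r - 1) + i)] (mod int (p ^ r)))"
proof -
  have period: "\<forall>\<^sub>F n in sequentially. [a (n + Carmichael k) = a n] (mod int k)"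
    if "k \<ge> 1" for k
    using that
    by (intro eventually_sequentiallyI[of k] cong_if_powers_cong[OF egf] power_add_Carmichael_cong)
       auto
  moreover have "\<exists>d>0. d dvd totient k \<and> (\<forall>\<^sub>F n in sequentially. [a (n + d) = a n] (mod int k))"
    if "k \<ge> 1" for k
    using period[OF that] by (intro exI[of _ "Carmichael k"]) (simp add: Carmichael_dvd_totient)
  moreover have "[a (n * p ^ r + i) = a (n * p ^ (r - 1) + i)] (mod int (p ^ r))"
    if "prime p" "r \<ge> 1" for i p n r :: nat
  proof (rule cong_if_powers_cong[OF egf])
    fix c :: nat
    have "[(c ^ p ^ r) ^ n * c ^ i = (c ^ p ^ (r - 1)) ^ n * c ^ i] (mod (p ^ r))"
      using that by (intro cong_mult cong_pow power_prime_power_cong cong_refl) auto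
    then show "[c ^ (n * p ^ r + i) = c ^ (n * p ^ (r - 1) + i)] (mod (p ^ r))"
      by (simp add: power_add mult.commute flip: power_mult)
  qed (use that in \<open>simp add: prime_gt_0_nat\<close>)
  ultimately show ?thesis
    by (auto simp: Carmichael_dvd_totient)
qed

end
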